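(* Let $\ell\ge 2$, let $k_1,\dots,k_\ell$ be positive integers with $k=\sum_{i=1}^\ell k_i$, and let $p_1,\dots,p_\ell>0$ with $\sum_{i=1}^\ell p_i=1$. Consider a sequence of $n$ independent trials, each taking value $i\in\{1,\dots,\ell\}$ with probability $p_i$, let $X^{(n)}$ be the number of $(k_1,\dots,k_\ell)$ patterns in it, and $P_{\ell,n}(m)=\mathbb{P}(X^{(n)}=m)$. Then \[ G_\ell(w,z):=\sum_{n\ge0}\sum_{m\ge0}P_{\ell,n}(m)\,w^mz^n=\frac{\prod_{i=2}^{\ell-1}(1-p_iz)}{(1-z)\prod_{i=2}^{\ell-1}(1-p_iz)-(w-1)\prod_{i=1}^{\ell}p_i^{k_i}\,z^k}, \] where an empty product equals $1$.
   Context: A $(k_1,\dots,k_\ell)$ pattern is an occurrence of a maximal run of at least $k_1$ consecutive $1$'s immediately followed by a maximal run of at least $k_2$ consecutive $2$'s, ..., immediately followed by a maximal run of at least $k_\ell$ consecutive $\ell$'s; $X^{(n)}$ counts such occurrences (e.g. for $\ell=3$, $k_1=2,k_2=1,k_3=2$, the sequence $223111233331121122233223311233312$ contains 3 of them). For $n=0$, $X^{(0)}=0$. *)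

theory Defs
  imports "HOL-Probability.Probability" "HOL-Computational_Algebra.Formal_Power_Series"
begin

definition maximal_run :: "nat list \<Rightarrow> nat \<Rightarrow> nat \<Rightarrow> nat \<Rightarrow> bool" where
  "maximal_run xs v s e \<longleftrightarrow>
     s < e \<and> e \<le> length xs \<and> (\<forall>j\<in>{s..<e}. xs ! j = v) \<and>
     (s = 0 \<or> xs ! (s - 1) \<noteq> v) \<and> (e = length xs \<or> xs ! e \<noteq> v)"

(* An occurrence is recorded by the list b of the l + 1 boundaries of its runs:
   the run of the value i fills the positions b ! (i - 1), ..., b ! i - 1 (counted from 0). *)
definition pattern_occs :: "nat \<Rightarrow> (nat \<Rightarrow> nat) \<Rightarrow> nat list \<Rightarrow> nat list set" where
  "pattern_occs l k xs =
     {b. length b = l + 1 \<and>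
         (\<forall>i\<in>{1..l}. maximal_run xs i (b ! (i - 1)) (b ! i) \<and> k i \<le> b ! i - b ! (i - 1))}"

definition pattern_count :: "nat \<Rightarrow> (nat \<Rightarrow> nat) \<Rightarrow> nat list \<Rightarrow> nat" where
  "pattern_count l k xs = card (pattern_occs l k xs)"

lemma finite_pattern_occs:
  assumes "l \<ge> 1"
  shows "finite (pattern_occs l k xs)"
proof (rule finite_subset)
  show "pattern_occs l k xs \<subseteq> {b. set b \<subseteq> {..length xs} \<and> length b = l + 1}"
  proof
    fix b assume b: "b \<in> pattern_occs l k xs"
    have "b ! j \<le> length xs" if "j < l + 1" for j
    proof (cases "j = 0")
      case True
      have "maximal_run xs 1 (b ! (1 - 1)) (b ! 1)"
        using b assms unfolding pattern_occs_def mem_Collect_eq by (meson atLeastAtMost_iff order_refl)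
      then show ?thesis using True by (simp add: maximal_run_def)
    next
      case False
      then have "maximal_run xs j (b ! (j - 1)) (b ! j)"
        using b that by (simp add: pattern_occs_def)
      then show ?thesis by (simp add: maximal_run_def)
    qed
    moreover have "length b = l + 1" using b by (simp add: pattern_occs_def)
    ultimately show "b \<in> {b. set b \<subseteq> {..length xs} \<and> length b = l + 1}"
      by (auto simp: in_set_conv_nth)
  qed
  show "finite {b. set b \<subseteq> {..length xs} \<and> length b = l + 1}"
    by (rule finite_lists_length_eq) simp
qed

(* Bivariate formal power series are series in z whose coefficients are series in w. *)
abbreviation fps_w :: "real fps fps" where
  "fps_w \<equiv> fps_const fps_X"

abbreviation fps_z :: "real fps fps" where
  "fps_z \<equiv> fps_X"

abbreviation fps_scalar :: "real \<Rightarrow> real fps fps" where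
  "fps_scalar c \<equiv> fps_const (fps_const c)"

definition bivariate_gf :: "(nat \<Rightarrow> nat \<Rightarrow> real) \<Rightarrow> real fps fps" where
  "bivariate_gf a = Abs_fps (\<lambda>n. Abs_fps (\<lambda>m. a n m))"

(* The coefficient ring real fps is not a field, so the library's division lemmas do not
   apply; for a denominator with constant term 1 the quotient is nevertheless the true one. *)
lemma bivariate_divide_iff:
  fixes f g h :: "real fps fps"
  assumes "fps_nth g 0 = 1"
  shows "h = f / g \<longleftrightarrow> h * g = f"
proof -
  have sd: "subdegree g = 0" using assms by (simp add: subdegree_eq_0_iff)
  have inv: "g * inverse g = 1"
    unfolding fps_inverse_def[of g] by (rule fps_right_inverse) (simp add: assms fps_inverse_one')
  have q: "f / g = f * inverse g" by (rule fps_divide_unit'[OF sd])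
  show ?thesis
  proof
    assume "h = f / g"
    then have "h * g = f * (g * inverse g)" by (simp only: q mult_ac)
    then show "h * g = f" by (simp add: inv)
  next
    assume "h * g = f"
    then have "f / g = h * g * inverse g" by (simp only: q)
    then have "f / g = h * (g * inverse g)" by (simp only: mult.assoc)
    then show "h = f / g" by (simp add: inv)
  qed
qed

end

(* Shrink an occurrence of the pattern to its core: the last k_1 ones, the full runs of 2, ..., l - 1
   and the first k_l letters l. Occurrences correspond to the positions at which a core word
   starts, cores cannot overlap, and no core word is a proper prefix of another. Writing A for the
   generating function of all words (with w marking the cores) and C for that of the core words,
   removing the first letter of a word gives A = 1 + z A + (w - 1) C A: the last term corrects the
   weight of the words that begin with a core, and such a word is a core followed by an arbitrary
   word. The middle runs contribute geometric series, so
   C (1 - p_2 z) ... (1 - p_{l-1} z) = p_1^{k_1} ... p_l^{k_l} z^k. *)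

theory Submission
  imports Defs
begin

section \<open>Weighted generating functions of languages\<close>

definition conc :: "'a list set \<Rightarrow> 'a list set \<Rightarrow> 'a list set" where
  "conc L K = (\<lambda>(u, v). u @ v) ` (L \<times> K)"

text \<open>The weights lie in an arbitrary commutative ring so that \<open>real fps\<close> may be
  used: w then lives in the coefficients and z is the series variable. Over a finite alphabet every
  slice of fixed length is finite, so the sum never falls back to its default value 0.\<close>

definition lang_gf :: "('a list \<Rightarrow> 'r::comm_ring_1) \<Rightarrow> 'a list set \<Rightarrow> 'r fps" where
  "lang_gf f L = Abs_fps (\<lambda>n. \<Sum>xs\<in>{xs \<in> L. length xs = n}. f xs)"

lemma finite_lang_slice:
  assumes "L \<subseteq> lists A" "finite A"
  shows "finite {xs \<in> L. length xs = n}"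
  by (rule finite_subset[OF _ finite_lists_length_eq[OF assms(2), of n]])
     (use assms(1) in auto)

text \<open>Unique factorisation turns the words of length n into pairs (u, v), and sorting these by
  the length of u gives the Cauchy product. Three separate weights are allowed because later the
  weight of \<open>u @ v\<close> splits into different kinds of functions on the two
  factors.\<close>

lemma lang_gf_conc:
  assumes fin: "L \<subseteq> lists A" "K \<subseteq> lists A" "finite A"
    and inj: "inj_on (\<lambda>(u, v). u @ v) (L \<times> K)"
    and f: "\<And>u v. u \<in> L \<Longrightarrow> v \<in> K \<Longrightarrow> f (u @ v) = g u * h v"
  shows "lang_gf f (conc L K) = lang_gf g L * lang_gf h K"
proof (rule fps_ext)
  fix n
  define S where "S L n = {xs \<in> L. length xs = n}" for L :: "'a list set" and n
  have fS: "finite (S L i)" "finite (S K i)" for i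
    unfolding S_def by (rule finite_lang_slice[OF fin(1,3)] finite_lang_slice[OF fin(2,3)])+
  have eq: "S (conc L K) n = (\<lambda>(u, v). u @ v) ` (\<Union>i\<in>{0..n}. S L i \<times> S K (n - i))"
    by (fastforce simp: S_def conc_def image_iff)
  have inj': "inj_on (\<lambda>(u, v). u @ v) (\<Union>i\<in>{0..n}. S L i \<times> S K (n - i))"
    by (rule inj_on_subset[OF inj]) (auto simp: S_def)
  have "(\<Sum>xs\<in>S (conc L K) n. f xs)
      = (\<Sum>(u, v)\<in>(\<Union>i\<in>{0..n}. S L i \<times> S K (n - i)). f (u @ v))"
    unfolding eq by (subst sum.reindex[OF inj']) (simp add: case_prod_beta' o_def)
  also have "\<dots> = (\<Sum>i=0..n. \<Sum>(u, v)\<in>S L i \<times> S K (n - i). f (u @ v))"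
    by (rule sum.UNION_disjoint) (use fS in \<open>auto simp: S_def\<close>)
  also have "\<dots> = (\<Sum>i=0..n. \<Sum>(u, v)\<in>S L i \<times> S K (n - i). g u * h v)"
    by (intro sum.cong refl) (auto simp: S_def f)
  also have "\<dots> = (\<Sum>i=0..n. (\<Sum>u\<in>S L i. g u) * (\<Sum>v\<in>S K (n - i). h v))"
    by (simp add: sum_product sum.cartesian_product)
  finally show "fps_nth (lang_gf f (conc L K)) n = fps_nth (lang_gf g L * lang_gf h K) n"
    by (simp add: lang_gf_def fps_mult_nth S_def)
qed

lemma lang_gf_singleton: "lang_gf f {u} = fps_const (f u) * fps_X ^ length u"
proof (rule fps_ext)
  fix n
  have "{xs \<in> {u}. length xs = n} = (if n = length u then {u} else {})" by auto
  then show "fps_nth (lang_gf f {u}) n = fps_nth (fps_const (f u) * fps_X ^ length u) n"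
    by (simp add: lang_gf_def)
qed

definition word_weight :: "('a \<Rightarrow> 'r::comm_ring_1) \<Rightarrow> 'a list \<Rightarrow> 'r" where
  "word_weight q xs = prod_list (map q xs)"

lemma word_weight_simps [simp]:
  "word_weight q [] = 1"
  "word_weight q (x # xs) = q x * word_weight q xs"
  "word_weight q (xs @ ys) = word_weight q xs * word_weight q ys"
  "word_weight q (replicate n x) = q x ^ n"
  by (simp_all add: word_weight_def)

text \<open>The geometric series with its denominator cleared, a form that makes sense over any
  coefficient ring and is kept for the core words below.\<close>

lemma lang_gf_replicate_ge:
  "lang_gf (word_weight q) {replicate n x | n. m \<le> n} * (1 - fps_const (q x) * fps_X)
     = (fps_const (q x) * fps_X) ^ m"
proof (rule fps_ext)
  fix n
  have sl: "{xs \<in> {replicate n x | n. m \<le> n}. length xs = n} = (if m \<le> n then {replicate n x} else {})"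
    for n by auto
  have nth: "fps_nth (lang_gf (word_weight q) {replicate n x | n. m \<le> n}) n = (if m \<le> n then q x ^ n else 0)"
    for n unfolding lang_gf_def by (simp only: sl fps_nth_Abs_fps) simp
  have "G * (1 - fps_const (q x) * fps_X) = G - fps_const (q x) * (G * fps_X)" for G
    by (simp add: algebra_simps)
  then show "fps_nth (lang_gf (word_weight q) {replicate n x | n. m \<le> n} * (1 - fps_const (q x) * fps_X)) n
      = fps_nth ((fps_const (q x) * fps_X) ^ m) n"
    by (cases n) (auto simp: nth power_mult_distrib)
qed

section \<open>Core words\<close>

definition block_word :: "(nat \<Rightarrow> nat) \<Rightarrow> nat \<Rightarrow> nat list" where
  "block_word a j = concat (map (\<lambda>i. replicate (a i) i) [1..<Suc j])"

lemma block_word_0 [simp]: "block_word a 0 = []"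
  by (simp add: block_word_def)

lemma block_word_Suc [simp]:
  "block_word a (Suc j) = block_word a j @ replicate (a (Suc j)) (Suc j)"
  by (simp add: block_word_def)

lemma block_word_cong:
  assumes "\<And>i. i \<in> {1..j} \<Longrightarrow> a i = b i"
  shows "block_word a j = block_word b j"
  using assms by (induction j) auto

lemma set_block_word: "set (block_word a j) \<subseteq> {1..j}"
  by (auto simp: block_word_def)

text \<open>Passage between a core and a full occurrence: further ones on the left and further
  letters \<open>l\<close> on the right only lengthen the two outer runs, which are distinct since
  \<open>l \<ge> 2\<close>.\<close>

lemma block_word_extend:
  assumes "l \<ge> 2"
  shows "block_word (a(1 := r + a 1, l := a l + s)) l = replicate r 1 @ block_word a l @ replicate s l"
proof -
  have u: "[1..<Suc l] = 1 # [2..<l] @ [l]"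
    using assms upt_conv_Cons[of 1 "l"] by (simp add: numeral_2_eq_2)
  have m: "map (\<lambda>i. replicate ((a(1 := r + a 1, l := a l + s)) i) i) [2..<l]
      = map (\<lambda>i. replicate (a i) i) [2..<l]"
    by (rule map_cong) auto
  show ?thesis unfolding block_word_def u using assms
    by (simp only: list.map concat.simps map_append concat_append m) (simp add: replicate_add)
qed

text \<open>Prefixes of cores. Trimming the run of ones to length exactly \<open>k 1\<close> gives
  the core a unique starting position within its occurrence.\<close>

definition blocks :: "(nat \<Rightarrow> nat) \<Rightarrow> nat \<Rightarrow> nat list set" where
  "blocks k j = {block_word a j | a. a 1 = k 1 \<and> (\<forall>i\<in>{2..j}. k i \<le> a i)}"

text \<open>Fixing the last run at length exactly \<open>k l\<close> leaves no choice for the end of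
  a core, which makes the set of cores prefix-free.\<close>

definition core_words :: "nat \<Rightarrow> (nat \<Rightarrow> nat) \<Rightarrow> nat list set" where
  "core_words l k = conc (blocks k (l - 1)) {replicate (k l) l}"

lemma blocks_1: "blocks k 1 = {replicate (k 1) 1}"
  by (auto simp: blocks_def)

lemma blocks_Suc:
  assumes "j \<ge> 1"
  shows "blocks k (Suc j) = conc (blocks k j) {replicate n (Suc j) | n. k (Suc j) \<le> n}"
proof
  show "blocks k (Suc j) \<subseteq> conc (blocks k j) {replicate n (Suc j) | n. k (Suc j) \<le> n}"
  proof
    fix u assume "u \<in> blocks k (Suc j)"
    then obtain a where "u = block_word a (Suc j)" "a 1 = k 1" "\<forall>i\<in>{2..Suc j}. k i \<le> a i"
      by (auto simp: blocks_def)
    then show "u \<in> conc (blocks k j) {replicate n (Suc j) | n. k (Suc j) \<le> n}"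
      using assms unfolding conc_def blocks_def
      by (intro image_eqI[of _ _ "(block_word a j, replicate (a (Suc j)) (Suc j))"]) auto
  qed
  show "conc (blocks k j) {replicate n (Suc j) | n. k (Suc j) \<le> n} \<subseteq> blocks k (Suc j)"
  proof
    fix u assume "u \<in> conc (blocks k j) {replicate n (Suc j) | n. k (Suc j) \<le> n}"
    then obtain a n where *: "u = block_word a j @ replicate n (Suc j)" "a 1 = k 1"
        "\<forall>i\<in>{2..j}. k i \<le> a i" "k (Suc j) \<le> n"
      by (auto simp: blocks_def conc_def)
    have "u = block_word (a(Suc j := n)) (Suc j)"
      using *(1) block_word_cong[of j a "a(Suc j := n)"] by auto
    then show "u \<in> blocks k (Suc j)"
      unfolding blocks_def using * assms by (intro CollectI exI[of _ "a(Suc j := n)"]) auto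
  qed
qed

text \<open>The recursive form suits generating functions; this explicit one suits the comparison
  with occurrences.\<close>

lemma core_words_eq:
  assumes "l \<ge> 2"
  shows "core_words l k
    = {block_word a l | a. a 1 = k 1 \<and> a l = k l \<and> (\<forall>i\<in>{2..<l}. k i \<le> a i)}"
proof -
  obtain j where l: "l = Suc j" "j \<ge> 1" using assms by (cases l) auto
  show ?thesis
  proof
    show "core_words l k \<subseteq> {block_word a l | a. a 1 = k 1 \<and> a l = k l \<and> (\<forall>i\<in>{2..<l}. k i \<le> a i)}"
    proof
      fix u assume "u \<in> core_words l k"
      then obtain a where a: "u = block_word a j @ replicate (k l) l" "a 1 = k 1" "\<forall>i\<in>{2..j}. k i \<le> a i"
        by (auto simp: core_words_def conc_def blocks_def l)
      have "u = block_word (a(l := k l)) l"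
        using a(1) block_word_cong[of j a "a(l := k l)"] l by auto
      then show "u \<in> {block_word a l | a. a 1 = k 1 \<and> a l = k l \<and> (\<forall>i\<in>{2..<l}. k i \<le> a i)}"
        using a l by (intro CollectI exI[of _ "a(l := k l)"]) auto
    qed
    show "{block_word a l | a. a 1 = k 1 \<and> a l = k l \<and> (\<forall>i\<in>{2..<l}. k i \<le> a i)} \<subseteq> core_words l k"
      using l by (fastforce simp: core_words_def conc_def blocks_def image_iff)
  qed
qed

lemma blocks_lists: "blocks k j \<subseteq> lists {1..j}"
  using set_block_word by (fastforce simp: blocks_def)

lemma core_words_lists:
  assumes "l \<ge> 2" shows "core_words l k \<subseteq> lists {1..l}"
  unfolding core_words_eq[OF assms] using set_block_word by fastforce

text \<open>Each appended run multiplies by a geometric series. The cleared denominators start at 2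
  because the run of ones has a fixed length.\<close>

lemma blocks_gf:
  fixes q :: "nat \<Rightarrow> 'r::comm_ring_1"
  assumes "j \<ge> 1"
  shows "lang_gf (word_weight q) (blocks k j) * (\<Prod>i=2..j. 1 - fps_const (q i) * fps_X)
    = (\<Prod>i=1..j. (fps_const (q i) * fps_X) ^ k i)"
  using assms
proof (induction j rule: dec_induct)
  case base
  show ?case
    unfolding blocks_1 by (simp add: lang_gf_singleton power_mult_distrib)
next
  case (step j)
  define R where "R = {replicate n (Suc j) | n. k (Suc j) \<le> n}"
  have B: "set u \<subseteq> {1..j}" if "u \<in> blocks k j" for u
    using that blocks_lists by fastforce
  have inj: "inj_on (\<lambda>(u, v). u @ v) (blocks k j \<times> R)"
  proof (rule inj_onI, clarify)
    fix u v u' v' assume uv: "u \<in> blocks k j" "v \<in> R" "u' \<in> blocks k j" "v' \<in> R" "u @ v = u' @ v'"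
    \<comment> \<open>The left factor uses only letters up to \<open>j\<close> and the right one
      only \<open>Suc j\<close>, so filtering recovers the left factor.\<close>
    have "filter (\<lambda>x. x \<le> j) (w @ y) = w" if "w \<in> blocks k j" "y \<in> R" for w y
      using B[OF that(1)] that(2) by (fastforce simp: R_def filter_empty_conv filter_id_conv)
    with uv show "u = u' \<and> v = v'" by (metis append_eq_append_conv)
  qed
  have "lang_gf (word_weight q) (blocks k (Suc j))
      = lang_gf (word_weight q) (blocks k j) * lang_gf (word_weight q) R" (is "?G' = ?G * ?H")
    unfolding blocks_Suc[OF step(1)] R_def[symmetric]
  proof (rule lang_gf_conc[where A = "{1..Suc j}"])
    show "blocks k j \<subseteq> lists {1..Suc j}" using B by fastforce
    show "R \<subseteq> lists {1..Suc j}" by (auto simp: R_def)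
  qed (use inj in auto)
  moreover have "?H * (1 - fps_const (q (Suc j)) * fps_X) = (fps_const (q (Suc j)) * fps_X) ^ k (Suc j)"
    unfolding R_def by (rule lang_gf_replicate_ge)
  ultimately have "?G' * ((\<Prod>i=2..j. 1 - fps_const (q i) * fps_X) * (1 - fps_const (q (Suc j)) * fps_X))
      = (\<Prod>i=1..j. (fps_const (q i) * fps_X) ^ k i) * (fps_const (q (Suc j)) * fps_X) ^ k (Suc j)"
    using step.IH by (metis (no_types, lifting) mult.assoc mult.left_commute)
  then show ?case using step(1) by (simp del: fps_const_mult add: prod.nat_ivl_Suc' mult_ac)
qed

text \<open>The last run has a fixed length too, so it contributes a monomial and the denominators
  stop at \<open>l-1\<close>.\<close>

lemma core_words_gf:
  fixes q :: "nat \<Rightarrow> 'r::comm_ring_1"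
  assumes "l \<ge> 2"
  shows "lang_gf (word_weight q) (core_words l k) * (\<Prod>i=2..l-1. 1 - fps_const (q i) * fps_X)
    = (\<Prod>i=1..l. (fps_const (q i) * fps_X) ^ k i)"
proof -
  have "lang_gf (word_weight q) (core_words l k)
      = lang_gf (word_weight q) (blocks k (l - 1)) * lang_gf (word_weight q) {replicate (k l) l}"
    unfolding core_words_def
  proof (rule lang_gf_conc[where A = "{1..l}"])
    show "blocks k (l - 1) \<subseteq> lists {1..l}" using blocks_lists[of k "l - 1"] by fastforce
    show "inj_on (\<lambda>(u, v). u @ v) (blocks k (l - 1) \<times> {replicate (k l) l})"
      by (auto simp: inj_on_def)
  qed (use assms in auto)
  moreover have "{1..l} = insert l {1..l-1}" using assms by auto
  ultimately show ?thesis using blocks_gf[of "l - 1" q k] assms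
    by (simp add: lang_gf_singleton power_mult_distrib mult_ac)
qed

section \<open>Pattern occurrences and starting points of core words\<close>

definition core_at :: "nat \<Rightarrow> (nat \<Rightarrow> nat) \<Rightarrow> nat list \<Rightarrow> bool" where
  "core_at l k xs \<longleftrightarrow> (\<exists>u\<in>core_words l k. \<exists>v. xs = u @ v)"

text \<open>For positive \<open>k\<close>, positions at or beyond the end contribute nothing,
  because the remaining word is empty and no core is.\<close>

definition core_count :: "nat \<Rightarrow> (nat \<Rightarrow> nat) \<Rightarrow> nat list \<Rightarrow> nat" where
  "core_count l k xs = card {j. core_at l k (drop j xs)}"

text \<open>This shape is what excludes overlaps: another core could only begin among the leading
  ones, and there only the first position leaves \<open>k 1\<close> of them.\<close>

lemma core_word_shape:
  assumes "l \<ge> 2" "k l > 0" "u \<in> core_words l k"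
  obtains t where "u = replicate (k 1) 1 @ t" "t \<noteq> []" "1 \<notin> set t"
proof -
  obtain a where a: "u = block_word a l" "a 1 = k 1" "a l = k l"
    using assms core_words_eq by auto
  define t where "t = concat (map (\<lambda>i. replicate (a i) i) [2..<Suc l])"
  have "[1..<Suc l] = 1 # [2..<Suc l]"
    using assms upt_conv_Cons[of 1 "Suc l"] by (simp add: numeral_2_eq_2)
  then have "u = replicate (k 1) 1 @ t"
    unfolding a block_word_def t_def by (simp only: list.map concat.simps a)
  moreover have "l \<in> set t" using assms a by (auto simp: t_def)
  moreover have "1 \<notin> set t" by (auto simp: t_def)
  ultimately show thesis using that by fastforce
qed

section \<open>Maximal runs and their end points\<close>

lemma maximal_run_take:
  assumes "maximal_run xs v s e"
  shows "take e xs = take s xs @ replicate (e - s) v"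
proof -
  have "take (e - s) (drop s xs) = replicate (e - s) v"
    using assms by (intro nth_equalityI) (auto simp: maximal_run_def)
  moreover have "take e xs = take s xs @ take (e - s) (drop s xs)"
    using assms take_add[of s "e - s" xs] by (simp add: maximal_run_def)
  ultimately show ?thesis by simp
qed

lemma maximal_run_append:
  assumes "r > 0" "ys = [] \<or> last ys \<noteq> v" "zs = [] \<or> hd zs \<noteq> v"
  shows "maximal_run (ys @ replicate r v @ zs) v (length ys) (length ys + r)"
  using assms
  by (cases "ys = []"; cases "zs = []") (auto simp: maximal_run_def nth_append last_conv_nth hd_conv_nth)

lemma maximal_run_start_unique:
  assumes "maximal_run xs v s e" "maximal_run xs v s' e"
  shows "s = s'"
proof -
  have False if "maximal_run xs v s e" "maximal_run xs v s' e" "s < s'" for s s'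
  proof -
    have "s' - 1 \<in> {s..<e}" using that by (auto simp: maximal_run_def)
    then have "xs ! (s' - 1) = v" "xs ! (s' - 1) \<noteq> v"
      using that unfolding maximal_run_def by (blast, auto)
    then show False by simp
  qed
  then show ?thesis using assms by (metis linorder_neqE_nat)
qed

lemma maximal_run_end_unique:
  assumes "maximal_run xs v s e" "maximal_run xs v s e'"
  shows "e = e'"
proof -
  have False if "maximal_run xs v s e" "maximal_run xs v s e'" "e < e'" for e e'
  proof -
    have "xs ! e = v" "xs ! e \<noteq> v"
      using that by (auto simp: maximal_run_def)
    then show False by simp
  qed
  then show ?thesis using assms by (metis linorder_neqE_nat)
qed

section \<open>Words that begin with a core, and why cores do not overlap\<close>

context
  fixes l :: nat and k :: "nat \<Rightarrow> nat"
  assumes l: "l \<ge> 2" and k: "\<forall>i\<in>{1..l}. k i > 0"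
begin

text \<open>The letter after the leading ones of a core exists and differs from 1, so it stops
  \<open>takeWhile\<close> inside the core, whatever follows.\<close>

lemma core_at_takeWhile:
  assumes "core_at l k xs"
  shows "length (takeWhile (\<lambda>x. x = 1) xs) = k 1"
proof -
  obtain u v where u: "u \<in> core_words l k" "xs = u @ v" using assms by (auto simp: core_at_def)
  obtain t where t: "u = replicate (k 1) 1 @ t" "t \<noteq> []" "1 \<notin> set t"
    using core_word_shape[OF l _ u(1)] k l by auto
  then obtain y t' where "t = y # t'" "y \<noteq> 1" by (cases t) auto
  then show ?thesis using t u by (simp add: takeWhile_append)
qed

lemma not_core_at:
  assumes "m < k 1" "t \<noteq> []" "1 \<notin> set t"
  shows "\<not> core_at l k (replicate m 1 @ t @ v)"
proof
  assume "core_at l k (replicate m 1 @ t @ v)"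
  from core_at_takeWhile[OF this] show False
    using assms by (cases t) (auto simp: takeWhile_append)
qed

lemma not_core_at_Nil [simp]: "\<not> core_at l k []"
  using core_at_takeWhile[of "[]"] k l by force

lemma finite_core_at: "finite {j. core_at l k (drop j xs)}"
  by (rule finite_subset[of _ "{..<length xs}"]) (use not_le in fastforce)+

lemma core_count_Nil [simp]: "core_count l k [] = 0"
  by (simp add: core_count_def)

lemma core_count_Cons:
  "core_count l k (x # xs) = core_count l k xs + of_bool (core_at l k (x # xs))"
proof -
  have eq: "{j. core_at l k (drop j (x # xs))}
      = (if core_at l k (x # xs) then {0} else {}) \<union> Suc ` {j. core_at l k (drop j xs)}"
    (is "?L = ?R")
  proof (rule set_eqI)
    show "j \<in> ?L \<longleftrightarrow> j \<in> ?R" for j by (cases j) auto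
  qed
  show ?thesis unfolding core_count_def eq
    by (subst card_Un_disjoint) (auto simp: finite_core_at card_image)
qed

lemma core_count_append_no_1:
  assumes "1 \<notin> set t"
  shows "core_count l k (t @ v) = core_count l k v"
  using assms
proof (induction t)
  case (Cons x t)
  then show ?case
    using not_core_at[of 0 "x # t" v] k l by (simp add: core_count_Cons)
qed simp

text \<open>Without its first letter, the core has fewer than \<open>k 1\<close> ones followed by a
  nonempty part free of ones. So no suffix starting before \<open>v\<close> begins with exactly
  \<open>k 1\<close> ones, and no core starts there.\<close>

lemma core_count_core_append:
  assumes "u \<in> core_words l k"
  shows "core_count l k (tl (u @ v)) = core_count l k v"
proof -
  obtain t where t: "u = replicate (k 1) 1 @ t" "t \<noteq> []" "1 \<notin> set t"
    using core_word_shape[OF l _ assms] k l by auto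
  have "core_count l k (replicate m 1 @ t @ v) = core_count l k v" if "m < k 1" for m
    using that
  proof (induction m)
    case 0
    then show ?case using core_count_append_no_1 t by simp
  next
    case (Suc m)
    then show ?case using not_core_at[of "Suc m" t v] t by (simp add: core_count_Cons)
  qed
  moreover have "k 1 > 0" using k l by auto
  ultimately show ?thesis by (cases "k 1") (auto simp: t)
qed

section \<open>Bijection between occurrences and core positions\<close>

lemma pattern_occsD:
  assumes "b \<in> pattern_occs l k xs" "i \<in> {1..l}"
  shows "maximal_run xs i (b ! (i - 1)) (b ! i)" "k i \<le> b ! i - b ! (i - 1)"
  using assms by (auto simp: pattern_occs_def)

text \<open>A maximal run is determined by either of its end points. Hence the boundary after the
  ones fixes boundary 0 to its left and, run by run, all boundaries to its right.\<close>

lemma pattern_occs_inj: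
  assumes "b \<in> pattern_occs l k xs" "c \<in> pattern_occs l k xs" "b ! 1 = c ! 1"
  shows "b = c"
proof -
  have 0: "b ! 0 = c ! 0"
    using maximal_run_start_unique pattern_occsD(1)[OF assms(1), of 1]
      pattern_occsD(1)[OF assms(2), of 1] assms(3) l by auto
  have "b ! i = c ! i" if "i \<le> l" "i \<ge> 1" for i
    using that(2,1)
  proof (induction i rule: dec_induct)
    case (step i)
    then show ?case
      using maximal_run_end_unique pattern_occsD(1)[OF assms(1), of "Suc i"]
        pattern_occsD(1)[OF assms(2), of "Suc i"] by auto
  qed (use assms(3) in simp)
  then have "b ! i = c ! i" if "i \<le> l" for i using 0 that by (cases i) auto
  then show ?thesis using assms by (intro nth_equalityI) (auto simp: pattern_occs_def)
qed

lemma pattern_occs_core_at: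
  assumes b: "b \<in> pattern_occs l k xs"
  shows "core_at l k (drop (b ! 1 - k 1) xs)"
proof -
  define a where "a = (\<lambda>i. b ! i - b ! (i - 1))"
  \<comment> \<open>The run lengths of the core: both outer runs are cut down to their minimal
    lengths, and the excess goes to the surrounding words.\<close>
  define a' where "a' = a(1 := k 1, l := k l)"
  have ka: "k i \<le> a i" if "i \<in> {1..l}" for i
    using pattern_occsD(2)[OF b that] by (simp add: a_def)
  have "take (b ! i) xs = take (b ! 0) xs @ block_word a i" if "i \<le> l" for i
    using that
  proof (induction i)
    case (Suc i)
    then show ?case
      using maximal_run_take pattern_occsD(1)[OF b, of "Suc i"] by (simp add: a_def)
  qed simp
  then have "xs = take (b ! 0) xs @ block_word a l @ drop (b ! l) xs"
    by (metis append.assoc append_take_drop_id order_refl)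
  moreover have "block_word a l = replicate (a 1 - k 1) 1 @ block_word a' l @ replicate (a l - k l) l"
  proof -
    have "a'(1 := (a 1 - k 1) + a' 1, l := a' l + (a l - k l)) = a"
      using ka[of 1] ka[of l] l by (auto simp: a'_def)
    then show ?thesis using block_word_extend[OF l, of a' "a 1 - k 1" "a l - k l"] by simp
  qed
  ultimately have xs: "xs = (take (b ! 0) xs @ replicate (a 1 - k 1) 1)
      @ block_word a' l @ replicate (a l - k l) l @ drop (b ! l) xs" (is "_ = ?ys @ _ @ ?zs")
    by simp
  have run: "maximal_run xs 1 (b ! 0) (b ! 1)" using pattern_occsD(1)[OF b, of 1] l by simp
  then have "length ?ys = b ! 1 - k 1"
    using ka[of 1] l by (auto simp: maximal_run_def a_def)
  then have "drop (b ! 1 - k 1) xs = block_word a' l @ ?zs"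
    by (subst xs) (simp only: append_eq_conv_conj[symmetric] append.assoc drop_append, simp)
  moreover have "block_word a' l \<in> core_words l k"
    unfolding core_words_eq[OF l] using ka l by (auto simp: a'_def)
  ultimately show ?thesis by (auto simp: core_at_def)
qed

text \<open>All runs are nonempty and their letters increase, so inside the block word each run is
  bordered by other letters and is maximal. The outer ends of the first and last runs are guarded by
  the conditions on \<open>ys\<close> and \<open>zs\<close>.\<close>

lemma block_word_occurrence:
  assumes ka: "\<forall>i\<in>{1..l}. k i \<le> a i"
    and ys: "ys = [] \<or> last ys \<noteq> 1" and zs: "zs = [] \<or> hd zs \<noteq> l"
  shows "map (\<lambda>i. length ys + length (block_word a i)) [0..<l+1]
    \<in> pattern_occs l k (ys @ block_word a l @ zs)"
proof -
  have run: "maximal_run (ys @ block_word a l @ zs) i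
      (length ys + length (block_word a (i - 1))) (length ys + length (block_word a i))"
    if i: "i \<in> {1..l}" for i
  proof -
    obtain j where j: "i = Suc j" using i by (cases i) auto
    have pos: "a m > 0" if "m \<in> {1..l}" for m using that ka k by force
    define r where "r = concat (map (\<lambda>i. replicate (a i) i) [Suc i..<Suc l])"
    have "[1..<Suc l] = [1..<Suc i] @ [Suc i..<Suc l]"
      using i upt_add_eq_append[of 1 "Suc i" "l - i"] by simp
    then have split: "block_word a l = block_word a j @ replicate (a i) i @ r"
      using block_word_Suc[of a j] unfolding r_def j block_word_def
      by (simp only: map_append concat_append append.assoc)
    have "ys @ block_word a j = [] \<or> last (ys @ block_word a j) \<noteq> i"
    proof (cases "j = 0")
      case True
      then show ?thesis using ys j by simp
    next
      case False
      then have "block_word a j \<noteq> []" using pos[of j] i j by (cases j) auto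
      then have "last (block_word a j) \<in> {1..j}" using set_block_word last_in_set by blast
      then show ?thesis using \<open>block_word a j \<noteq> []\<close> j by simp
    qed
    moreover have "r @ zs = [] \<or> hd (r @ zs) \<noteq> i"
    proof (cases "i = l")
      case True
      then show ?thesis using zs by (simp add: r_def)
    next
      case False
      then have "Suc i \<in> {1..l}" using i by auto
      then have "Suc i \<in> set r" using pos[of "Suc i"]
        by (auto simp: r_def intro!: bexI[of _ "Suc i"])
      then have "r \<noteq> []" by auto
      moreover have "set r \<subseteq> {Suc i..l}" by (auto simp: r_def)
      ultimately show ?thesis using hd_in_set by fastforce
    qed
    ultimately have "maximal_run ((ys @ block_word a j) @ replicate (a i) i @ r @ zs) i
        (length (ys @ block_word a j)) (length (ys @ block_word a j) + a i)"
      by (intro maximal_run_append pos i)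
    then show ?thesis using split j by (simp add: add.assoc)
  qed
  have len: "length (block_word a i) - length (block_word a (i - 1)) = a i" if "i \<in> {1..l}" for i
    using that by (cases i) auto
  have nth: "map (\<lambda>i. length ys + length (block_word a i)) [0..<l+1] ! i
      = length ys + length (block_word a i)" if "i \<le> l" for i
    using that by (subst nth_map) (auto simp del: upt_Suc)
  show ?thesis unfolding pattern_occs_def mem_Collect_eq
  proof (intro conjI ballI)
    fix i assume i: "i \<in> {1..l}"
    then have "i \<le> l" "i - 1 \<le> l" by auto
    with i run[OF i] ka len[OF i] show
      "maximal_run (ys @ block_word a l @ zs) i
        (map (\<lambda>i. length ys + length (block_word a i)) [0..<l+1] ! (i - 1))
        (map (\<lambda>i. length ys + length (block_word a i)) [0..<l+1] ! i)"
      "k i \<le> map (\<lambda>i. length ys + length (block_word a i)) [0..<l+1] ! i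
        - map (\<lambda>i. length ys + length (block_word a i)) [0..<l+1] ! (i - 1)"
      by (simp_all only: nth) auto
  qed simp
qed

text \<open>Converse to \<open>pattern_occs_core_at\<close>: the core grows to an occurrence by
  absorbing all ones directly before it and all letters \<open>l\<close> directly after it.\<close>

lemma core_at_pattern_occ:
  assumes "core_at l k (drop j xs)"
  obtains b where "b \<in> pattern_occs l k xs" "b ! 1 - k 1 = j"
proof -
  have "j < length xs" using assms not_le_imp_less by fastforce
  obtain a v where a: "drop j xs = block_word a l @ v" "a 1 = k 1" "a l = k l" "\<forall>i\<in>{2..<l}. k i \<le> a i"
    using assms unfolding core_at_def core_words_eq[OF l] by auto
  \<comment> \<open>Since \<open>takeWhile\<close> scans from the left, the ones directly before
    position \<open>j\<close> are read off the reversed prefix.\<close>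
  define r where "r = length (takeWhile (\<lambda>x. x = 1) (rev (take j xs)))"
  define ys where "ys = rev (dropWhile (\<lambda>x. x = 1) (rev (take j xs)))"
  define s where "s = length (takeWhile (\<lambda>x. x = l) v)"
  define zs where "zs = dropWhile (\<lambda>x. x = l) v"
  have tw: "takeWhile (\<lambda>x. x = c) w = replicate (length (takeWhile (\<lambda>x. x = c) w)) c" for c :: nat and w
    by (rule replicate_eqI[symmetric, THEN sym]) (auto dest: set_takeWhileD)
  have "rev (take j xs) = replicate r 1 @ rev ys"
    unfolding r_def ys_def rev_rev_ident using tw takeWhile_dropWhile_id by metis
  then have tj: "take j xs = ys @ replicate r 1" by (metis rev_append rev_replicate rev_rev_ident)
  have v: "v = replicate s l @ zs" unfolding s_def zs_def using tw takeWhile_dropWhile_id by metis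
  define a' where "a' = a(1 := r + a 1, l := a l + s)"
  have xs: "xs = ys @ block_word a' l @ zs"
    using append_take_drop_id[of j xs] unfolding a'_def block_word_extend[OF l] a(1) tj v by simp
  define b where "b = map (\<lambda>i. length ys + length (block_word a' i)) [0..<l+1]"
  have "b \<in> pattern_occs l k xs"
    unfolding b_def xs
  proof (rule block_word_occurrence)
    show "\<forall>i\<in>{1..l}. k i \<le> a' i"
    proof
      fix i assume "i \<in> {1..l}"
      then consider "i = 1" | "i = l" | "i \<in> {2..<l}" by force
      then show "k i \<le> a' i" using a by cases (auto simp: a'_def)
    qed
    show "ys = [] \<or> last ys \<noteq> 1"
      unfolding ys_def using hd_dropWhile[of "\<lambda>x. x = 1" "rev (take j xs)"] by (auto simp: last_rev)
    show "zs = [] \<or> hd zs \<noteq> l"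
      unfolding zs_def using hd_dropWhile[of "\<lambda>x. x = l" v] by auto
  qed
  moreover have "b ! 1 = length ys + length (block_word a' 1)"
    unfolding b_def using l by (subst nth_map) (auto simp del: upt_Suc)
  then have "b ! 1 = length ys + r + k 1" using a l by (simp add: a'_def)
  moreover have "length ys + r = j" using arg_cong[OF tj, of length] \<open>j < length xs\<close> by simp
  ultimately show thesis using that by simp
qed

lemma pattern_count_eq: "pattern_count l k xs = core_count l k xs"
proof -
  have "inj_on (\<lambda>b. b ! 1 - k 1) (pattern_occs l k xs)"
  proof (rule inj_onI)
    fix b c assume bc: "b \<in> pattern_occs l k xs" "c \<in> pattern_occs l k xs" "b ! 1 - k 1 = c ! 1 - k 1"
    \<comment> \<open>Subtraction on naturals truncates; these bounds make the cancellation of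
      \<open>k 1\<close> legitimate.\<close>
    have "k 1 \<le> b ! 1" "k 1 \<le> c ! 1"
      using pattern_occsD(2)[OF bc(1), of 1] pattern_occsD(2)[OF bc(2), of 1] l by auto
    then show "b = c" using bc pattern_occs_inj by (metis eq_diff_iff)
  qed
  moreover have "(\<lambda>b. b ! 1 - k 1) ` pattern_occs l k xs = {j. core_at l k (drop j xs)}"
    using pattern_occs_core_at core_at_pattern_occ by (auto simp: image_iff) metis
  ultimately show ?thesis unfolding pattern_count_def core_count_def by (metis card_image)
qed

section \<open>The generating function of the core count\<close>

text \<open>The letter \<open>l\<close> occurs only in the final run of a core. What precedes the
  first \<open>l\<close> is thus the core without that run, whose length is known, so the core can
  be recovered from any extension.\<close>

lemma inj_on_core_append: "inj_on (\<lambda>(u, v). u @ v) (core_words l k \<times> K)"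
proof (rule inj_onI, clarify)
  fix u v u' v' assume uv: "u \<in> core_words l k" "u' \<in> core_words l k" "u @ v = u' @ v'"
  have *: "\<exists>w. u = w @ replicate (k l) l \<and> takeWhile (\<lambda>x. x \<noteq> l) (u @ v) = w"
    if u: "u \<in> core_words l k" for u v
  proof -
    obtain w where w: "w \<in> blocks k (l - 1)" "u = w @ replicate (k l) l"
      using u by (auto simp: core_words_def conc_def)
    have "l \<notin> set w" using blocks_lists[of k "l - 1"] w(1) l by fastforce
    moreover have "k l > 0" using k l by auto
    then obtain n where "k l = Suc n" by (cases "k l") auto
    ultimately have "takeWhile (\<lambda>x. x \<noteq> l) (u @ v) = w"
      using w by (auto simp: takeWhile_append)
    then show ?thesis using w by auto
  qed
  from *[OF uv(1), of v] *[OF uv(2), of v'] uv(3) have "u = u'" by metis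
  then show "u = u' \<and> v = v'" using uv(3) by simp
qed

lemma core_count_gf:
  fixes q :: "nat \<Rightarrow> 'r::comm_ring_1" and w :: 'r
  assumes q: "(\<Sum>i=1..l. q i) = 1"
  defines "A \<equiv> lang_gf (\<lambda>xs. word_weight q xs * w ^ core_count l k xs) (lists {1..l})"
  shows "A = 1 + fps_X * A + fps_const (w - 1) * lang_gf (word_weight q) (core_words l k) * A"
proof -
  define f where "f xs = word_weight q xs * w ^ core_count l k xs" for xs
  \<comment> \<open>\<open>g\<close> disregards a core at the very start. On nonempty words
    \<open>f\<close> is therefore \<open>w * g\<close> if a core starts there and \<open>g\<close>
    otherwise, whence the factor \<open>w - 1\<close>.\<close>
  define g where "g xs = word_weight q xs * w ^ core_count l k (tl xs)" for xs
  define L where "L = (\<lambda>i. [i]) ` {1..l}"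
  have A: "A = lang_gf f (lists {1..l})" by (simp add: A_def f_def[abs_def])
  have split_f: "f xs = g xs + (w - 1) * (if core_at l k xs then g xs else 0)" if "xs \<noteq> []" for xs
    using that by (cases xs) (auto simp: f_def g_def core_count_Cons algebra_simps)
  have fin: "finite {xs \<in> lists {1..l}. length xs = n}" for n
    by (rule finite_lang_slice[where A = "{1..l}"]) auto
  have "A = 1 + (lang_gf g (conc L (lists {1..l}))
      + fps_const (w - 1) * lang_gf g (conc (core_words l k) (lists {1..l})))"
  proof (rule fps_ext)
    fix n
    have L: "xs \<in> conc L (lists {1..l}) \<longleftrightarrow> xs \<in> lists {1..l} \<and> xs \<noteq> []" for xs
      by (cases xs) (auto simp: conc_def L_def image_iff)
    have C: "xs \<in> conc (core_words l k) (lists {1..l}) \<longleftrightarrow> xs \<in> lists {1..l} \<and> core_at l k xs" for xs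
      using core_words_lists[OF l, of k] by (fastforce simp: conc_def core_at_def image_iff)
    define S where "S = {xs \<in> lists {1..l}. length xs = n}"
    have fS: "finite S" using fin by (simp add: S_def)
    have LC: "fps_nth (lang_gf g (conc (core_words l k) (lists {1..l}))) n
        = (\<Sum>xs\<in>S. if core_at l k xs then g xs else 0)"
      using fS unfolding lang_gf_def C by (simp add: sum.inter_filter[symmetric] S_def conj_ac)
    show "fps_nth A n = fps_nth (1 + (lang_gf g (conc L (lists {1..l}))
      + fps_const (w - 1) * lang_gf g (conc (core_words l k) (lists {1..l})))) n"
    proof (cases "n = 0")
      case True
      then have "S = {[]}" by (auto simp: S_def)
      then have "fps_nth A n = f []" using True by (simp add: A lang_gf_def S_def)
      moreover have "fps_nth (lang_gf g (conc L (lists {1..l}))) n = 0"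
        using True unfolding lang_gf_def L fps_nth_Abs_fps by (intro sum.neutral) auto
      ultimately show ?thesis using LC True \<open>S = {[]}\<close> by (simp add: f_def)
    next
      case False
      then have ne: "xs \<noteq> []" if "xs \<in> S" for xs using that by (auto simp: S_def)
      have "fps_nth A n = (\<Sum>xs\<in>S. g xs + (w - 1) * (if core_at l k xs then g xs else 0))"
        unfolding A lang_gf_def fps_nth_Abs_fps S_def[symmetric] using split_f ne by (intro sum.cong) auto
      moreover have "fps_nth (lang_gf g (conc L (lists {1..l}))) n = (\<Sum>xs\<in>S. g xs)"
        using ne unfolding lang_gf_def L by (auto simp: S_def intro!: sum.cong)
      ultimately show ?thesis using False LC by (simp add: sum.distrib sum_distrib_left)
    qed
  qed
  \<comment> \<open>Here \<open>tl\<close> removes exactly the letter from \<open>L\<close>, so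
    \<open>g\<close> is the weight of that letter times \<open>f\<close> of the rest.\<close>
  also have "lang_gf g (conc L (lists {1..l})) = lang_gf (word_weight q) L * A"
    unfolding A
  proof (rule lang_gf_conc[where A = "{1..l}"])
    show "inj_on (\<lambda>(u, v). u @ v) (L \<times> lists {1..l})" by (auto simp: inj_on_def L_def)
  qed (auto simp: L_def f_def g_def mult_ac)
  \<comment> \<open>The one-letter words have total weight 1, because the \<open>q i\<close> sum to
    1.\<close>
  also have "lang_gf (word_weight q) L = fps_X"
  proof (rule fps_ext)
    fix n
    have "{xs \<in> L. length xs = n} = (if n = 1 then L else {})" by (auto simp: L_def)
    moreover have "(\<Sum>xs\<in>L. word_weight q xs) = 1"
      unfolding L_def using q by (subst sum.reindex) (auto simp: inj_on_def)
    ultimately show "fps_nth (lang_gf (word_weight q) L) n = fps_nth fps_X n"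
      by (simp add: lang_gf_def)
  qed
  \<comment> \<open>By \<open>core_count_core_append\<close>, the leading core contributes only its
    word weight and leaves \<open>f\<close> of the rest.\<close>
  also have "lang_gf g (conc (core_words l k) (lists {1..l})) = lang_gf (word_weight q) (core_words l k) * A"
    unfolding A
  proof (rule lang_gf_conc[where A = "{1..l}"])
    show "core_words l k \<subseteq> lists {1..l}" by (rule core_words_lists[OF l])
  qed (auto simp: inj_on_core_append f_def g_def core_count_core_append mult_ac)
  finally show ?thesis by (simp add: algebra_simps)
qed

end

section \<open>Probabilities as weighted word counts\<close>

lemma (in prob_space) prob_word:
  fixes Y :: "nat \<Rightarrow> 'a \<Rightarrow> nat"
  assumes indep: "indep_vars (\<lambda>_. count_space UNIV) Y {..<n}"
    and dist: "\<And>j i. j < n \<Longrightarrow> i \<in> {1..l} \<Longrightarrow> prob {\<omega> \<in> space M. Y j \<omega> = i} = p i"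
    and xs: "xs \<in> lists {1..l}" "length xs = n"
  shows "prob {\<omega> \<in> space M. map (\<lambda>j. Y j \<omega>) [0..<n] = xs} = word_weight p xs"
\<comment> \<open>The case of no trials is separate: an intersection over no indices would be
  \<open>UNIV\<close> instead of the sample space.\<close>
proof (cases "n = 0")
  case True
  then show ?thesis using xs by (simp add: prob_space)
next
  case False
  have *: "{\<omega> \<in> space M. map (\<lambda>j. Y j \<omega>) [0..<n] = xs}
      = (\<Inter>j\<in>{..<n}. Y j -` {xs ! j} \<inter> space M)"
    using False xs(2) by (auto simp: list_eq_iff_nth_eq)
  have "prob {\<omega> \<in> space M. map (\<lambda>j. Y j \<omega>) [0..<n] = xs}
      = (\<Prod>j\<in>{..<n}. prob (Y j -` {xs ! j} \<inter> space M))"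
    unfolding * by (rule indep_varsD[OF indep]) (use False in auto)
  also have "\<dots> = (\<Prod>j<n. p (xs ! j))"
  proof (rule prod.cong)
    fix j assume "j \<in> {..<n}"
    moreover from this have "xs ! j \<in> {1..l}" using xs by (auto simp: in_lists_conv_set)
    moreover have "Y j -` {xs ! j} \<inter> space M = {\<omega> \<in> space M. Y j \<omega> = xs ! j}" by auto
    ultimately show "prob (Y j -` {xs ! j} \<inter> space M) = p (xs ! j)" using dist by simp
  qed simp
  also have "\<dots> = word_weight p xs"
    unfolding word_weight_def prod.list_conv_set_nth using xs(2) by (simp add: atLeast0LessThan)
  finally show ?thesis .
qed

text \<open>The values outside \<open>{1..l}\<close> have probability 0 because the
  \<open>p i\<close> already sum to 1. So almost surely the event is a finite disjoint union of
  single-word events.\<close>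

lemma (in prob_space) prob_word_statistic:
  fixes Y :: "nat \<Rightarrow> 'a \<Rightarrow> nat" and N :: "nat list \<Rightarrow> 'b"
  assumes indep: "indep_vars (\<lambda>_. count_space UNIV) Y {..<n}"
    and dist: "\<And>j i. j < n \<Longrightarrow> i \<in> {1..l} \<Longrightarrow> prob {\<omega> \<in> space M. Y j \<omega> = i} = p i"
    and p: "(\<Sum>i=1..l. p i) = 1"
  shows "prob {\<omega> \<in> space M. N (map (\<lambda>j. Y j \<omega>) [0..<n]) = m}
    = (\<Sum>xs | xs \<in> lists {1..l} \<and> length xs = n \<and> N xs = m. word_weight p xs)"
proof -
  define E where "E xs = {\<omega> \<in> space M. map (\<lambda>j. Y j \<omega>) [0..<n] = xs}" for xs
  define S where "S = {xs \<in> lists {1..l}. length xs = n \<and> N xs = m}"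
  have fS: "finite S"
    unfolding S_def by (rule finite_subset[OF _ finite_lang_slice[of "lists {1..l}" "{1..l}" n]]) auto
  have Y: "Y j \<in> measurable M (count_space UNIV)" if "j < n" for j
    using indep that by (auto simp: indep_vars_def)
  have E: "E xs \<in> events" for xs
  proof -
    have "E xs = {\<omega> \<in> space M. length xs = n \<and> (\<forall>j\<in>{..<n}. Y j \<omega> = xs ! j)}"
      by (auto simp: E_def list_eq_iff_nth_eq)
    moreover have "{\<omega> \<in> space M. \<forall>j\<in>{..<n}. Y j \<omega> = xs ! j} \<in> events"
    proof (rule sets.sets_Collect_finite_All)
      fix j assume "j \<in> {..<n}"
      then have "Y j -` {xs ! j} \<inter> space M \<in> events" using Y by (intro measurable_sets[OF Y]) auto
      moreover have "Y j -` {xs ! j} \<inter> space M = {\<omega> \<in> space M. Y j \<omega> = xs ! j}" by auto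
      ultimately show "{\<omega> \<in> space M. Y j \<omega> = xs ! j} \<in> events" by simp
    qed simp
    ultimately show ?thesis by (cases "length xs = n") auto
  qed
  have "AE \<omega> in M. Y j \<omega> \<in> {1..l}" if j: "j < n" for j
  proof -
    have m: "Y j -` A \<inter> space M \<in> events" for A using measurable_sets[OF Y[OF j], of A] by simp
    have "prob (Y j -` {1..l} \<inter> space M) = prob (\<Union>i\<in>{1..l}. Y j -` {i} \<inter> space M)"
      by (rule arg_cong[of _ _ prob]) auto
    also have "\<dots> = (\<Sum>i=1..l. prob (Y j -` {i} \<inter> space M))"
      by (rule finite_measure_finite_Union) (use m in \<open>auto simp: disjoint_family_on_def\<close>)
    also have "\<dots> = (\<Sum>i=1..l. p i)"
    proof (rule sum.cong)
      fix i assume "i \<in> {1..l}"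
      moreover have "Y j -` {i} \<inter> space M = {\<omega> \<in> space M. Y j \<omega> = i}" by auto
      ultimately show "prob (Y j -` {i} \<inter> space M) = p i" using dist[OF j] by simp
    qed simp
    finally have "AE \<omega> in M. \<omega> \<in> Y j -` {1..l} \<inter> space M"
      using p m by (subst AE_in_set_eq_1) auto
    then show ?thesis by (rule AE_mp) auto
  qed
  then have "AE \<omega> in M. \<forall>j\<in>{..<n}. Y j \<omega> \<in> {1..l}" by (intro AE_finite_allI) auto
  then have AE: "AE \<omega> in M. \<omega> \<in> {\<omega> \<in> space M. N (map (\<lambda>j. Y j \<omega>) [0..<n]) = m} \<longleftrightarrow> \<omega> \<in> (\<Union>xs\<in>S. E xs)"
    by (rule AE_mp) (auto simp: S_def E_def in_lists_conv_set intro!: AE_I2)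
  \<comment> \<open>Measurability for arbitrary \<open>N\<close>: there are only countably many
    words over the naturals, so the event is a countable union of single-word events.\<close>
  have "{\<omega> \<in> space M. N (map (\<lambda>j. Y j \<omega>) [0..<n]) = m} = (\<Union>xs\<in>{xs. N xs = m}. E xs)"
    by (auto simp: E_def)
  also have "\<dots> \<in> events" by (rule sets.countable_UN') (use E in auto)
  finally have "prob {\<omega> \<in> space M. N (map (\<lambda>j. Y j \<omega>) [0..<n]) = m} = prob (\<Union>xs\<in>S. E xs)"
    using AE E fS by (intro finite_measure_eq_AE sets.finite_UN) auto
  also have "\<dots> = (\<Sum>xs\<in>S. prob (E xs))"
    using E fS by (intro finite_measure_finite_Union) (auto simp: disjoint_family_on_def E_def)
  also have "\<dots> = (\<Sum>xs\<in>S. word_weight p xs)"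
    using prob_word[OF indep dist] by (intro sum.cong) (auto simp: S_def E_def)
  finally show ?thesis by (simp add: S_def)
qed

lemma word_weight_fps_const: "word_weight (\<lambda>i. fps_const (p i)) xs = fps_const (word_weight p xs)"
  by (induction xs) auto

text \<open>The factor \<open>fps_X ^ N xs\<close> places the weight of a word into the coefficient
  with index \<open>N xs\<close>, which sorts the words of length n by their statistic.\<close>

lemma bivariate_gf_word_statistic:
  fixes N :: "nat list \<Rightarrow> nat"
  assumes "\<And>n m. P n m = (\<Sum>xs | xs \<in> lists {1..l} \<and> length xs = n \<and> N xs = m. word_weight p xs)"
  shows "bivariate_gf P
    = lang_gf (\<lambda>xs. word_weight (\<lambda>i. fps_const (p i)) xs * fps_X ^ N xs) (lists {1..l})"
proof (intro fps_ext)
  fix n m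
  define S where "S = {xs \<in> lists {1..l}. length xs = n}"
  have fS: "finite S" unfolding S_def by (rule finite_lang_slice[where A = "{1..l}"]) auto
  have eq: "{xs. xs \<in> lists {1..l} \<and> length xs = n \<and> N xs = m} = {xs \<in> S. N xs = m}"
    by (auto simp: S_def)
  have "fps_nth (fps_nth (bivariate_gf P) n) m = (\<Sum>xs\<in>{xs \<in> S. N xs = m}. word_weight p xs)"
    by (simp only: bivariate_gf_def fps_nth_Abs_fps assms eq)
  also have "\<dots> = (\<Sum>xs\<in>S. if N xs = m then word_weight p xs else 0)"
    by (rule sum.inter_filter[OF fS])
  also have "\<dots> = (\<Sum>xs\<in>S. fps_nth (fps_const (word_weight p xs) * fps_X ^ N xs) m)"
    by (intro sum.cong refl) auto
  finally show "fps_nth (fps_nth (bivariate_gf P) n) m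
    = fps_nth (fps_nth (lang_gf (\<lambda>xs. word_weight (\<lambda>i. fps_const (p i)) xs * fps_X ^ N xs)
        (lists {1..l})) n) m"
    by (simp add: lang_gf_def S_def word_weight_fps_const fps_sum_nth)
qed

text \<open>Only the law of each \<open>X n\<close> enters the series, so each number of trials may
  have its own probability space \<open>M n\<close>.\<close>

theorem theorem1:
  fixes l :: nat and k :: "nat \<Rightarrow> nat" and p :: "nat \<Rightarrow> real"
    and M :: "nat \<Rightarrow> 'a measure" and Y :: "nat \<Rightarrow> nat \<Rightarrow> 'a \<Rightarrow> nat"
    and X :: "nat \<Rightarrow> 'a \<Rightarrow> nat" and P :: "nat \<Rightarrow> nat \<Rightarrow> real"
  assumes "l \<ge> 2"
    and "\<forall>i\<in>{1..l}. k i > 0"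
    and "\<forall>i\<in>{1..l}. p i > 0"
    and "(\<Sum>i=1..l. p i) = 1"
    and "\<And>n. prob_space (M n)"
    and "\<And>n. prob_space.indep_vars (M n) (\<lambda>_. count_space UNIV) (Y n) {..<n}"
    and "\<And>n j i. j < n \<Longrightarrow> i \<in> {1..l} \<Longrightarrow> measure (M n) {\<omega> \<in> space (M n). Y n j \<omega> = i} = p i"
    and "\<And>n \<omega>. X n \<omega> = pattern_count l k (map (\<lambda>j. Y n j \<omega>) [0..<n])"
    and "\<And>n m. P n m = measure (M n) {\<omega> \<in> space (M n). X n \<omega> = m}"
  shows "bivariate_gf P =
    (\<Prod>i=2..l-1. 1 - fps_scalar (p i) * fps_z) /
    ((1 - fps_z) * (\<Prod>i=2..l-1. 1 - fps_scalar (p i) * fps_z)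
      - (fps_w - 1) * (\<Prod>i=1..l. fps_scalar (p i) ^ k i) * fps_z ^ (\<Sum>i=1..l. k i))"
proof -
  define Q where "Q = (\<Prod>i=2..l-1. 1 - fps_scalar (p i) * fps_z)"
  define R where "R = (\<Prod>i=1..l. fps_scalar (p i) ^ k i) * fps_z ^ (\<Sum>i=1..l. k i)"
  define q where "q = (\<lambda>i. fps_const (p i))"
  define C where "C = lang_gf (word_weight q) (core_words l k)"
  define A where "A = lang_gf (\<lambda>xs. word_weight q xs * fps_X ^ core_count l k xs) (lists {1..l})"
  have "P n m = (\<Sum>xs | xs \<in> lists {1..l} \<and> length xs = n \<and> core_count l k xs = m. word_weight p xs)"
    for n m
    unfolding assms(8,9) pattern_count_eq[OF assms(1,2)]
    using prob_space.prob_word_statistic[OF assms(5,6,7,4)] by simp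
  then have gf: "bivariate_gf P = A"
    unfolding A_def q_def by (rule bivariate_gf_word_statistic)
  have "(\<Sum>i=1..l. q i) = 1"
    using assms(4) unfolding q_def by (intro fps_ext) (simp add: fps_sum_nth)
  \<comment> \<open>The ring element marking cores is now w itself, that is, \<open>fps_X\<close> of
    the coefficient ring.\<close>
  then have A: "A = 1 + fps_z * A + (fps_w - 1) * C * A"
    using core_count_gf[OF assms(1,2), of q fps_X] by (simp add: A_def C_def fps_const_sub[symmetric] del: fps_const_sub)
  have "(\<Prod>i=1..l. fps_z ^ k i) = fps_z ^ (\<Sum>i=1..l. k i)" by (rule power_sum[symmetric])
  then have "C * Q = R"
    using core_words_gf[OF assms(1), of q k]
    by (simp add: C_def Q_def R_def q_def power_mult_distrib prod.distrib)
  \<comment> \<open>Multiplying the functional equation by \<open>Q\<close> replaces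
    \<open>C\<close> by the explicit \<open>R\<close>, with no division by the factors of
    \<open>Q\<close>.\<close>
  have "A * ((1 - fps_z) * Q - (fps_w - 1) * R) = (A - fps_z * A - (fps_w - 1) * C * A) * Q"
    unfolding \<open>C * Q = R\<close>[symmetric] by (simp add: algebra_simps)
  also have "A - fps_z * A - (fps_w - 1) * C * A = 1" by (subst (1) A) simp
  finally have "A * ((1 - fps_z) * Q - (fps_w - 1) * R) = Q" by simp
  \<comment> \<open>Constant term 1 is what \<open>bivariate_divide_iff\<close> asks for: the
    factors of \<open>Q\<close> have constant term 1, and \<open>R\<close> carries a positive power
    of z.\<close>
  moreover have "fps_nth ((1 - fps_z) * Q - (fps_w - 1) * R) 0 = 1"
  proof -
    have "k 1 \<le> (\<Sum>i=1..l. k i)" using assms(1) by (intro member_le_sum) auto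
    moreover have "k 1 > 0" using assms(1,2) by auto
    ultimately have "(\<Sum>i=1..l. k i) > 0" by linarith
    then obtain d where d: "(\<Sum>i=1..l. k i) = Suc d" using gr0_implies_Suc by blast
    have "fps_nth R 0 = 0" unfolding R_def d by simp
    moreover have "fps_nth Q 0 = 1"
    proof -
      have "fps_nth (\<Prod>i\<in>I. 1 - fps_scalar (p i) * fps_z) 0 = 1" for I
        by (induction I rule: infinite_finite_induct) auto
      then show ?thesis by (simp add: Q_def)
    qed
    ultimately show ?thesis by simp
  qed
  ultimately have "A = Q / ((1 - fps_z) * Q - (fps_w - 1) * R)"
    using bivariate_divide_iff by blast
  then show ?thesis by (simp only: gf Q_def R_def mult.assoc)
qed

end
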